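(* Let $S=\langle n_1,n_2,n_3\rangle$, with $n_1<n_2<n_3$, be a numerical semigroup with embedding dimension three. Assume that $S$ has three Betti elements (equivalently, $S$ is nonsymmetric). For $\{i,j,k\}=\{1,2,3\}$ let $c_i$ be the least positive integer $t$ such that $t n_i\in\langle n_j,n_k\rangle$, and let $r_{ij},r_{ik}$ be the unique nonnegative integers (which are in fact positive) such that $$c_in_i=r_{ij}n_j+r_{ik}n_k.$$ Then $$\max(\Delta(S))+2=\mathrm{c}(S)$$ if and only if at least one of the following conditions holds: \begin{itemize} \item $r_{12}=r_{13}=1$, $r_{21}+r_{23}>c_2$ and $c_1\ge\max\{r_{21}+r_{23},\,r_{31}+r_{32}\}$; \item $c_3=2$ and $r_{31}+r_{32}\ge\max\{c_1,c_2\}$. \end{itemize}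
   Context: $\mathbb{N}$ denotes the set of nonnegative integers. A numerical semigroup is a subset of $\mathbb{N}$ closed under addition, containing $0$, with finite complement in $\mathbb{N}$. Every numerical semigroup $S$ has a unique minimal system of generators $\{n_1<\dots<n_p\}$; we write $S=\langle n_1,\dots,n_p\rangle$, and $p$ is called the embedding dimension of $S$. In general $\langle n_j,n_k\rangle=\{xn_j+yn_k\mid x,y\in\mathbb{N}\}$. A numerical semigroup $S$ is symmetric if and only if $\#(\mathbb{N}\setminus S)=(\mathrm{F}(S)+1)/2$, where $\mathrm{F}(S)=\max(\mathbb{Z}\setminus S)$. For $s\in S$, the set of factorizations of $s$ is $\mathrm{Z}(s)=\{(a_1,\dots,a_p)\in\mathbb{N}^p \mid a_1n_1+\dots+a_pn_p=s\}$. The length of $x=(x_1,\dots,x_p)\in\mathbb{N}^p$ is $|x|=x_1+\dots+x_p$, and the set of lengths of $s$ is $\mathrm{L}(s)=\{|x| \mid x\in\mathrm{Z}(s)\}$, a finite set. If $\mathrm{L}(s)=\{l_1<\dots<l_k\}$, then $\Delta(s)=\{l_2-l_1,\dots,l_k-l_{k-1}\}$ (empty if $k=1$), and the Delta set of $S$ is $\Delta(S)=\bigcup_{s\in S}\Delta(s)$. For $x,y\in\mathbb{N}^p$, let $x\wedge y=(\min\{x_1,y_1\},\dots,\min\{x_p,y_p\})$ and $\mathrm{d}(x,y)=\max\{|x|,|y|\}-|x\wedge y|$. For $N\in\mathbb{N}$, an $N$-chain of factorizations of $s$ is a sequence $z_0,\dots,z_k\in\mathrm{Z}(s)$ with $\mathrm{d}(z_{i-1},z_i)\le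 N$ for all $i\in\{1,\dots,k\}$. The catenary degree $\mathrm{c}(s)$ of $s\in S$ is the least $N\in\mathbb{N}\cup\{\infty\}$ such that any two factorizations of $s$ are joined by an $N$-chain of factorizations of $s$. The catenary degree of $S$ is $\mathrm{c}(S)=\sup\{\mathrm{c}(s)\mid s\in S\}$. For $s\in S$, let $\nabla_s$ be the graph with vertex set $\mathrm{Z}(s)$ in which $a,b$ are joined by an edge if there is an index $i$ with $a_i\ne0$ and $b_i\neq 0$. An element $s\in S$ is a Betti element of $S$ if $\nabla_s$ is not connected. *)

theory Defs
  imports Main "HOL-Library.Extended_Nat"
begin

definition numerical_semigroup :: "nat set \<Rightarrow> bool" where
  "numerical_semigroup S \<longleftrightarrow>
     0 \<in> S \<and> (\<forall>x\<in>S. \<forall>y\<in>S. x + y \<in> S) \<and> finite (UNIV - S)"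

definition generated :: "nat set \<Rightarrow> nat set" where
  "generated A = {(\<Sum>a\<in>F. x a * a) | F x. finite F \<and> F \<subseteq> A}"

text \<open>The minimal system of generators, listed in increasing order.  All notions below depend
  on the semigroup through this list, whose length is the embedding dimension.\<close>

definition minimal_generators :: "nat set \<Rightarrow> nat list \<Rightarrow> bool" where
  "minimal_generators S ns \<longleftrightarrow>
     sorted_wrt (<) ns \<and> generated (set ns) = S \<and>
     (\<forall>B. B \<subset> set ns \<longrightarrow> generated B \<noteq> S)"

definition factorizations :: "nat list \<Rightarrow> nat \<Rightarrow> nat list set" where
  "factorizations ns s =
     {a. length a = length ns \<and> (\<Sum>i<length ns. a ! i * ns ! i) = s}"

text \<open>The length \<open>|x|\<close> of a tuple \<open>x\<close> is its coordinate sum \<^term>\<open>sum_list x\<close>, not the number of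
  its coordinates.\<close>

definition length_set :: "nat list \<Rightarrow> nat \<Rightarrow> nat set" where
  "length_set ns s = sum_list ` factorizations ns s"

definition delta :: "nat list \<Rightarrow> nat \<Rightarrow> nat set" where
  "delta ns s = {m - l | l m. l \<in> length_set ns s \<and> m \<in> length_set ns s \<and> l < m \<and>
                   (\<forall>k\<in>length_set ns s. \<not> (l < k \<and> k < m))}"

definition delta_set :: "nat list \<Rightarrow> nat set" where
  "delta_set ns = (\<Union>s\<in>generated (set ns). delta ns s)"

definition fac_dist :: "nat list \<Rightarrow> nat list \<Rightarrow> nat" where
  "fac_dist x y = max (sum_list x) (sum_list y) - sum_list (map2 min x y)"

definition fac_chain :: "nat list \<Rightarrow> nat \<Rightarrow> enat \<Rightarrow> nat list list \<Rightarrow> bool" where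
  "fac_chain ns s N zs \<longleftrightarrow>
     zs \<noteq> [] \<and> set zs \<subseteq> factorizations ns s \<and>
     successively (\<lambda>x y. enat (fac_dist x y) \<le> N) zs"

definition elem_catenary_degree :: "nat list \<Rightarrow> nat \<Rightarrow> enat" where
  "elem_catenary_degree ns s =
     (LEAST N. \<forall>a\<in>factorizations ns s. \<forall>b\<in>factorizations ns s.
        \<exists>zs. fac_chain ns s N zs \<and> hd zs = a \<and> last zs = b)"

definition catenary_degree :: "nat list \<Rightarrow> enat" where
  "catenary_degree ns = (SUP s\<in>generated (set ns). elem_catenary_degree ns s)"

definition nabla_edges :: "nat list \<Rightarrow> nat \<Rightarrow> (nat list \<times> nat list) set" where
  "nabla_edges ns s = {(a, b). a \<in> factorizations ns s \<and> b \<in> factorizations ns s \<and>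
                         (\<exists>i<length ns. a ! i \<noteq> 0 \<and> b ! i \<noteq> 0)}"

definition nabla_connected :: "nat list \<Rightarrow> nat \<Rightarrow> bool" where
  "nabla_connected ns s \<longleftrightarrow>
     (\<forall>a\<in>factorizations ns s. \<forall>b\<in>factorizations ns s. (a, b) \<in> (nabla_edges ns s)\<^sup>*)"

definition betti_elements :: "nat list \<Rightarrow> nat set" where
  "betti_elements ns = {s \<in> generated (set ns). \<not> nabla_connected ns s}"

end

theory Submission
  imports Defs
begin

text \<open>Write \<open>l\<^sub>i = r\<^sub>i\<^sub>j + r\<^sub>i\<^sub>k\<close>.  Everything is governed by the three relations
  \<open>c\<^sub>i n\<^sub>i = r\<^sub>i\<^sub>j n\<^sub>j + r\<^sub>i\<^sub>k n\<^sub>k\<close>.  A disconnected graph \<open>\<nabla>\<^sub>s\<close> forces \<open>s = c\<^sub>i n\<^sub>i\<close> for some \<open>i\<close>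
  (\<open>betti_elements_subset\<close>), so having three Betti elements means that the numbers \<open>c\<^sub>i n\<^sub>i\<close> are
  pairwise distinct.  Minimality of the \<open>c\<^sub>i\<close> then yields Herzog's description of the nonsymmetric
  case: all \<open>r\<^sub>i\<^sub>j\<close> are positive (\<open>r_pos\<close>), \<open>c\<^sub>i = r\<^sub>j\<^sub>i + r\<^sub>k\<^sub>i\<close> (\<open>c_eq_sum\<close>), and \<open>c\<^sub>i n\<^sub>i\<close> has exactly
  two factorizations, of lengths \<open>c\<^sub>i\<close> and \<open>l\<^sub>i\<close> and with disjoint supports
  (\<open>two_factorizations\<close>).

  Any two factorizations of an element are joined by a path that at each step exchanges
  \<open>c\<^sub>i\<close> copies of \<open>n\<^sub>i\<close> for the other factorization of \<open>c\<^sub>i n\<^sub>i\<close>, or conversely (\<open>moves_connect\<close>).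
  Such a step covers the distance \<open>max c\<^sub>i l\<^sub>i\<close> and changes the length by \<open>\<bar>c\<^sub>i - l\<^sub>i\<bar>\<close>.  Hence the
  catenary degree is at most the maximum of the numbers \<open>max c\<^sub>i l\<^sub>i\<close>.  Moreover, a path from one
  length to the next larger one has to jump over the gap between them, so every gap is at most the
  maximum of the numbers \<open>\<bar>c\<^sub>i - l\<^sub>i\<bar>\<close>.  Both bounds are attained at some \<open>c\<^sub>i n\<^sub>i\<close>
  (\<open>catenary_degree_eq\<close>, \<open>Max_delta_set\<close>).

  Since \<open>n\<^sub>1 < n\<^sub>2 < n\<^sub>3\<close>, we have \<open>l\<^sub>1 < c\<^sub>1\<close> and \<open>c\<^sub>3 < l\<^sub>3\<close>, while the three differences \<open>c\<^sub>i - l\<^sub>i\<close>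
  add up to zero; so the largest gap is \<open>max (c\<^sub>1 - l\<^sub>1) (l\<^sub>3 - c\<^sub>3)\<close>.  As \<open>l\<^sub>1\<close> and \<open>c\<^sub>3\<close> are at least \<open>2\<close>,
  adding \<open>2\<close> to it reaches the catenary degree only if \<open>l\<^sub>1 = 2\<close> and \<open>c\<^sub>1\<close> is the catenary degree,
  or \<open>c\<^sub>3 = 2\<close> and \<open>l\<^sub>3\<close> is the catenary degree.  The remaining simplification of the two
  alternatives is linear arithmetic (\<open>criterion_arithmetic\<close>).\<close>

section \<open>Vectors of three coefficients\<close>

text \<open>Factorizations are lists indexed from \<open>0\<close>, the generators are numbered from \<open>1\<close>.  A coefficient
  function on the indices \<open>1, 2, 3\<close> lets arguments be carried out once for an arbitrary
  permutation \<open>i, j, k\<close> of the indices.\<close>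

definition vec3 :: "(nat \<Rightarrow> nat) \<Rightarrow> nat list" where
  "vec3 f = [f 1, f 2, f 3]"

lemma perm3_cases:
  assumes "{i, j, k} = {1, 2, 3 :: nat}"
  obtains "i = 1" "j = 2" "k = 3" | "i = 1" "j = 3" "k = 2" | "i = 2" "j = 1" "k = 3"
    | "i = 2" "j = 3" "k = 1" | "i = 3" "j = 1" "k = 2" | "i = 3" "j = 2" "k = 1"
proof -
  have "card {i, j, k} = 3"
    unfolding assms by simp
  then have "i \<noteq> j" "i \<noteq> k" "j \<noteq> k"
    by (auto simp: card_insert_if split: if_splits)
  moreover have "i \<in> {1, 2, 3}" "j \<in> {1, 2, 3}" "k \<in> {1, 2, 3}"
    using assms by blast+
  ultimately show thesis
    using that by (elim insertE emptyE; simp)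
qed

lemma perm3_rotate:
  assumes "{i, j, k} = {1, 2, 3 :: nat}"
  shows "{j, k, i} = {1, 2, 3}" "{k, i, j} = {1, 2, 3}" "{i, k, j} = {1, 2, 3}"
    "{j, i, k} = {1, 2, 3}"
  using assms by (auto simp: insert_commute)

lemma perm3_distinct:
  assumes "{i, j, k} = {1, 2, 3 :: nat}"
  shows "i \<noteq> j" "i \<noteq> k" "j \<noteq> k" "j \<noteq> i" "k \<noteq> i" "k \<noteq> j"
  by (rule perm3_cases[OF assms]; simp)+

lemma perm3_mem:
  assumes "{i, j, k} = {1, 2, 3 :: nat}"
  shows "i \<in> {1, 2, 3}" "j \<in> {1, 2, 3}" "k \<in> {1, 2, 3}"
  unfolding assms[symmetric] by simp_all

lemma perm3_complete:
  assumes "i \<in> {1, 2, 3 :: nat}"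
  obtains j k where "{i, j, k} = {1, 2, 3}"
proof -
  consider "i = 1" | "i = 2" | "i = 3" using assms by blast
  then show thesis
  proof cases
    case 1 show thesis by (rule that[of 2 3]) (use 1 in auto)
  next
    case 2 show thesis by (rule that[of 1 3]) (use 2 in auto)
  next
    case 3 show thesis by (rule that[of 1 2]) (use 3 in auto)
  qed
qed

lemma vec3_eq_iff:
  assumes "{i, j, k} = {1, 2, 3}"
  shows "vec3 f = vec3 g \<longleftrightarrow> f i = g i \<and> f j = g j \<and> f k = g k"
  using assms by (elim perm3_cases) (auto simp: vec3_def)

lemma sum_list_vec3:
  assumes "{i, j, k} = {1, 2, 3}"
  shows "sum_list (vec3 f) = f i + f j + f k"
  using assms by (elim perm3_cases) (auto simp: vec3_def)

lemma fac_dist_vec3: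
  "fac_dist (vec3 f) (vec3 g) =
     max (sum_list (vec3 f)) (sum_list (vec3 g)) - sum_list (vec3 (\<lambda>m. min (f m) (g m)))"
  by (simp add: fac_dist_def vec3_def)

lemma generatedI: "finite F \<Longrightarrow> F \<subseteq> A \<Longrightarrow> (\<Sum>u\<in>F. x u * u) \<in> generated A"
  unfolding generated_def by blast

lemma generated_pair:
  assumes "a \<noteq> b"
  shows "generated {a, b} = {x * a + y * b | x y. True}"
proof (intro set_eqI iffI)
  fix t assume "t \<in> generated {a, b}"
  then obtain F x where t: "t = (\<Sum>u\<in>F. x u * u)" and F: "finite F" "F \<subseteq> {a, b}"
    unfolding generated_def by blast
  define y where "y u = (if u \<in> F then x u else 0)" for u
  have "t = (\<Sum>u\<in>{a, b}. y u * u)"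
    unfolding t by (rule sum.mono_neutral_cong_left) (use F in \<open>auto simp: y_def\<close>)
  also have "\<dots> = y a * a + y b * b"
    using assms by simp
  finally show "t \<in> {x * a + y * b | x y. True}" by blast
next
  fix t assume "t \<in> {x * a + y * b | x y. True}"
  then obtain x y where "t = x * a + y * b" by blast
  then have "t = (\<Sum>u\<in>{a, b}. (if u = a then x else y) * u)"
    using assms by simp
  then show "t \<in> generated {a, b}"
    by (simp only: generatedI finite.intros order_refl)
qed

lemma multiple_in_generated:
  assumes "a \<in> A"
  shows "t * a \<in> generated A"
  using generatedI[of "{a}" A "\<lambda>_. t"] assms by simp

lemma generated_insert_0: "generated (insert 0 A) = generated A"
proof (intro set_eqI iffI)
  fix t assume "t \<in> generated (insert 0 A)"
  then obtain F x where t: "t = (\<Sum>u\<in>F. x u * u)" and F: "finite F" "F \<subseteq> insert 0 A"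
    unfolding generated_def by blast
  have "t = (\<Sum>u\<in>F - {0}. x u * u)"
    unfolding t by (rule sum.mono_neutral_right) (use F in auto)
  moreover have "finite (F - {0})" "F - {0} \<subseteq> A" using F by auto
  ultimately show "t \<in> generated A" by (simp only: generatedI)
next
  fix t assume "t \<in> generated A"
  then show "t \<in> generated (insert 0 A)" unfolding generated_def by blast
qed

text \<open>A generator \<open>0\<close> contributes nothing to any sum, so it could be dropped from a system of
  generators.\<close>

lemma minimal_generators_nonzero:
  assumes "minimal_generators S ns"
  shows "0 \<notin> set ns"
proof
  assume "0 \<in> set ns"
  then have "insert 0 (set ns - {0}) = set ns" by auto
  then have "generated (set ns - {0}) = S"
    using generated_insert_0[of "set ns - {0}"] assms by (simp add: minimal_generators_def)
  moreover have "set ns - {0} \<subset> set ns" using \<open>0 \<in> set ns\<close> by auto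
  ultimately show False using assms by (auto simp: minimal_generators_def)
qed

section \<open>Chains and the catenary degree of an element\<close>

text \<open>A path that starts inside a set and ends outside of it has a step that leaves the set.  This
  turns a path of short steps into a lower bound for its longest step.\<close>

lemma rtranclp_crossing:
  assumes "R\<^sup>*\<^sup>* a b" "P a" "\<not> P b"
  obtains x y where "R\<^sup>*\<^sup>* a x" "R x y" "P x" "\<not> P y"
proof -
  have "\<exists>x y. R\<^sup>*\<^sup>* a x \<and> R x y \<and> P x \<and> \<not> P y"
    using assms by (induction rule: rtranclp_induct) blast+
  then show thesis using that by blast
qed

text \<open>An \<open>N\<close>-chain is a path for this relation, which makes induction along paths available.\<close>

definition fac_step :: "nat list \<Rightarrow> nat \<Rightarrow> enat \<Rightarrow> nat list \<Rightarrow> nat list \<Rightarrow> bool" where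
  "fac_step ns s N x y \<longleftrightarrow>
     x \<in> factorizations ns s \<and> y \<in> factorizations ns s \<and> enat (fac_dist x y) \<le> N"

lemma fac_chain_imp_steps:
  assumes "fac_chain ns s N zs"
  shows "(fac_step ns s N)\<^sup>*\<^sup>* (hd zs) (last zs)"
  using assms
proof (induction zs rule: induct_list012)
  case (3 x y zs)
  then have "fac_step ns s N x y" "fac_chain ns s N (y # zs)"
    by (auto simp: fac_chain_def fac_step_def)
  then show ?case
    using 3 by (auto intro: converse_rtranclp_into_rtranclp)
qed (auto simp: fac_chain_def)

lemma steps_imp_fac_chain:
  assumes "(fac_step ns s N)\<^sup>*\<^sup>* a b" "b \<in> factorizations ns s"
  shows "\<exists>zs. fac_chain ns s N zs \<and> hd zs = a \<and> last zs = b"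
  using assms
proof (induction rule: converse_rtranclp_induct)
  case base
  then show ?case by (intro exI[of _ "[b]"]) (simp add: fac_chain_def)
next
  case (step x y)
  then obtain zs where zs: "fac_chain ns s N zs" "hd zs = y" "last zs = b" by blast
  then show ?case
    using step(1) by (intro exI[of _ "x # zs"])
      (auto simp: fac_chain_def fac_step_def successively_Cons)
qed

text \<open>For \<open>N = \<infinity>\<close> any two factorizations are joined by a single step, hence the least \<open>N\<close> in the
  definition exists and has the defining property, which is monotone in \<open>N\<close>.\<close>

lemma elem_catenary_degree_le_iff:
  "elem_catenary_degree ns s \<le> N \<longleftrightarrow>
     (\<forall>a\<in>factorizations ns s. \<forall>b\<in>factorizations ns s. (fac_step ns s N)\<^sup>*\<^sup>* a b)"
    (is "_ \<longleftrightarrow> ?joined N")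
proof -
  have eq: "elem_catenary_degree ns s = (LEAST N. ?joined N)"
    unfolding elem_catenary_degree_def
    by (rule arg_cong[where f = Least], rule ext)
      (metis fac_chain_imp_steps steps_imp_fac_chain)
  have "?joined \<infinity>"
    by (auto simp: fac_step_def)
  then have least: "?joined (elem_catenary_degree ns s)"
    unfolding eq by (rule LeastI)
  have mono: "?joined N'" if "?joined N" "N \<le> N'" for N N'
  proof -
    have "fac_step ns s N \<le> fac_step ns s N'"
      using that(2) by (auto simp: fac_step_def)
    then show ?thesis using that(1) rtranclp_mono by blast
  qed
  show ?thesis
  proof
    assume "elem_catenary_degree ns s \<le> N"
    then show "?joined N" using least mono by blast
  next
    assume "?joined N"
    then show "elem_catenary_degree ns s \<le> N" unfolding eq by (rule Least_le)
  qed
qed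

section \<open>Least multiples of the generators\<close>

locale least_multiples =
  fixes n c :: "nat \<Rightarrow> nat" and r :: "nat \<Rightarrow> nat \<Rightarrow> nat"
  assumes n_pos: "i \<in> {1, 2, 3} \<Longrightarrow> 0 < n i"
    and c_pos: "i \<in> {1, 2, 3} \<Longrightarrow> 0 < c i"
    and c_le: "\<lbrakk>{i, j, k} = {1, 2, 3}; 0 < t; t * n i = x * n j + y * n k\<rbrakk> \<Longrightarrow> c i \<le> t"
    and c_eq: "{i, j, k} = {1, 2, 3} \<Longrightarrow> c i * n i = r i j * n j + r i k * n k"
begin

abbreviation gens :: "nat list" where
  "gens \<equiv> [n 1, n 2, n 3]"

definition weight :: "(nat \<Rightarrow> nat) \<Rightarrow> nat" where
  "weight f = f 1 * n 1 + f 2 * n 2 + f 3 * n 3"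

lemma weight_perm:
  assumes "{i, j, k} = {1, 2, 3}"
  shows "weight f = f i * n i + f j * n j + f k * n k"
  using assms by (elim perm3_cases) (auto simp: weight_def)

lemma weight_add: "weight (\<lambda>m. f m + g m) = weight f + weight g"
  by (simp add: weight_def algebra_simps)

lemma perm3_pos:
  assumes "{i, j, k} = {1, 2, 3}"
  shows "0 < n i" "0 < n j" "0 < n k" "0 < c i" "0 < c j" "0 < c k"
  using n_pos c_pos assms by blast+

lemma weight_eq_0_iff:
  assumes "{i, j, k} = {1, 2, 3}"
  shows "weight f = 0 \<longleftrightarrow> f i = 0 \<and> f j = 0 \<and> f k = 0"
  using weight_perm[OF assms, of f] perm3_pos[OF assms] by auto

lemma vec3_in_factorizations: "vec3 f \<in> factorizations gens s \<longleftrightarrow> weight f = s"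
  by (simp add: factorizations_def vec3_def weight_def eval_nat_numeral)

lemma factorizations_eq: "factorizations gens s = {vec3 f | f. weight f = s}"
proof (intro set_eqI iffI)
  fix z assume z: "z \<in> factorizations gens s"
  then have "length z = 3" by (simp add: factorizations_def)
  then obtain a b d where "z = [a, b, d]"
    by (auto simp: numeral_3_eq_3 length_Suc_conv)
  then have eq: "z = vec3 (\<lambda>m. z ! (m - 1))" by (simp add: vec3_def numeral_2_eq_2)
  with z have "weight (\<lambda>m. z ! (m - 1)) = s" by (metis vec3_in_factorizations)
  with eq show "z \<in> {vec3 f | f. weight f = s}"
    by (intro CollectI exI[of _ "\<lambda>m. z ! (m - 1)"] conjI)
next
  fix z assume "z \<in> {vec3 f | f. weight f = s}"
  then show "z \<in> factorizations gens s" using vec3_in_factorizations by blast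
qed

text \<open>The left-hand and the right-hand side of \<open>c i * n i = r i j * n j + r i k * n k\<close>, read as
  two factorizations of the same element.\<close>

definition pure :: "nat \<Rightarrow> nat \<Rightarrow> nat" where
  "pure i m = (if m = i then c i else 0)"

definition mixed :: "nat \<Rightarrow> nat \<Rightarrow> nat" where
  "mixed i m = (if m = i then 0 else r i m)"

lemma weight_pure:
  assumes "i \<in> {1, 2, 3}"
  shows "weight (pure i) = c i * n i"
  using assms by (auto simp: weight_def pure_def)

lemma weight_mixed:
  assumes "i \<in> {1, 2, 3}"
  shows "weight (mixed i) = c i * n i"
proof -
  obtain j k where ijk: "{i, j, k} = {1, 2, 3}" using perm3_complete[OF assms] .
  show ?thesis
    unfolding weight_perm[OF ijk] using c_eq[OF ijk] perm3_distinct[OF ijk]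
    by (simp add: mixed_def)
qed

text \<open>Meant for \<open>c i \<le> f i\<close>, so that the truncated subtraction is exact.\<close>

definition exchange :: "nat \<Rightarrow> (nat \<Rightarrow> nat) \<Rightarrow> nat \<Rightarrow> nat" where
  "exchange i f m = f m - pure i m + mixed i m"

lemma weight_exchange:
  assumes "i \<in> {1, 2, 3}" "c i \<le> f i"
  shows "weight (exchange i f) = weight f"
proof -
  have f: "f = (\<lambda>m. f m - pure i m + pure i m)"
    using assms(2) by (auto simp: pure_def)
  have "weight (exchange i f) = weight (\<lambda>m. f m - pure i m) + weight (mixed i)"
    unfolding exchange_def[abs_def] by (rule weight_add)
  also have "\<dots> = weight (\<lambda>m. f m - pure i m) + weight (pure i)"
    using assms by (simp add: weight_pure weight_mixed)
  also have "\<dots> = weight (\<lambda>m. f m - pure i m + pure i m)" by (rule weight_add[symmetric])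
  also have "\<dots> = weight f" using f by simp
  finally show ?thesis .
qed

lemma r_pos_or:
  assumes "{i, j, k} = {1, 2, 3}"
  shows "0 < r i j \<or> 0 < r i k"
  using c_eq[OF assms] perm3_pos[OF assms] by (cases "r i j"; cases "r i k") auto

text \<open>If two factorizations share no generator, then one of them involves only a single generator
  \<open>n i\<close>, because the three indices are divided between the two supports.  The other one then
  exhibits \<open>f i * n i\<close> as a combination of the remaining generators, so \<open>f i\<close> is at least \<open>c i\<close>.\<close>

lemma disjoint_cases:
  assumes wt: "weight f = weight g" "0 < weight f"
    and disj: "\<forall>m\<in>{1, 2, 3}. f m = 0 \<or> g m = 0"
  obtains i j k where "{i, j, k} = {1, 2, 3}" "f j = 0" "f k = 0" "g i = 0" "c i \<le> f i"
    | i j k where "{i, j, k} = {1, 2, 3}" "g j = 0" "g k = 0" "f i = 0" "c i \<le> g i"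
proof -
  have single: "h' i = 0 \<and> c i \<le> h i"
    if ijk: "{i, j, k} = {1, 2, 3}" and h: "h j = 0" "h k = 0" "weight h = weight h'"
      "0 < weight h" "h i = 0 \<or> h' i = 0" for h h' :: "nat \<Rightarrow> nat" and i j k
  proof -
    have pos: "0 < h i"
      using h weight_eq_0_iff[OF ijk, of h] by auto
    then have h': "h' i = 0" using h by simp
    have "h i * n i = h' j * n j + h' k * n k"
      using h weight_perm[OF ijk, of h] weight_perm[OF ijk, of h'] h' by simp
    then show ?thesis using c_le[OF ijk pos] h' by blast
  qed
  have "\<exists>i j k. {i, j, k} = {1, 2, 3} \<and> (f j = 0 \<and> f k = 0 \<or> g j = 0 \<and> g k = 0)"
  proof -
    have p: "{1, 2, 3} = {1, 2, 3 :: nat}" "{2, 1, 3} = {1, 2, 3 :: nat}"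
      "{3, 1, 2} = {1, 2, 3 :: nat}" by auto
    have "f 1 = 0 \<or> g 1 = 0" "f 2 = 0 \<or> g 2 = 0" "f 3 = 0 \<or> g 3 = 0" using disj by simp_all
    then consider "f 1 = 0 \<and> f 2 = 0 \<or> g 1 = 0 \<and> g 2 = 0"
      | "f 1 = 0 \<and> f 3 = 0 \<or> g 1 = 0 \<and> g 3 = 0" | "f 2 = 0 \<and> f 3 = 0 \<or> g 2 = 0 \<and> g 3 = 0"
      by argo
    then show ?thesis
    proof cases
      case 1 then show ?thesis using p(3) by (intro exI[of _ 3] exI[of _ 1] exI[of _ 2]) simp
    next
      case 2 then show ?thesis using p(2) by (intro exI[of _ 2] exI[of _ 1] exI[of _ 3]) simp
    next
      case 3 then show ?thesis using p(1) by (intro exI[of _ 1] exI[of _ 2] exI[of _ 3]) simp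
    qed
  qed
  then obtain i j k where ijk: "{i, j, k} = {1, 2, 3}"
    and "f j = 0 \<and> f k = 0 \<or> g j = 0 \<and> g k = 0" by blast
  moreover have "f i = 0 \<or> g i = 0" using bspec[OF disj perm3_mem(1)[OF ijk]] .
  ultimately show thesis
    using that single[of i j k f g] single[of i j k g f] wt by auto
qed

section \<open>Betti elements\<close>

lemma nabla_edge:
  assumes "weight f = s" "weight g = s" "m \<in> {1, 2, 3}" "0 < f m" "0 < g m"
  shows "(vec3 f, vec3 g) \<in> nabla_edges gens s"
proof -
  have "m - 1 < 3 \<and> vec3 f ! (m - 1) = f m \<and> vec3 g ! (m - 1) = g m"
    using assms(3) by (auto simp: vec3_def numeral_2_eq_2)
  then have "\<exists>i<length gens. vec3 f ! i \<noteq> 0 \<and> vec3 g ! i \<noteq> 0"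
    using assms by (intro exI[of _ "m - 1"]) auto
  then show ?thesis
    using assms unfolding nabla_edges_def
    by (simp only: vec3_in_factorizations mem_Collect_eq case_prod_conv simp_thms)
qed

lemma sym_nabla_edges: "sym (nabla_edges ns s)"
  by (auto simp: sym_def nabla_edges_def)

text \<open>If a multiple \<open>f i * n i\<close> of a single generator is different from \<open>c i * n i\<close>, then
  exchanging \<open>c i\<close> copies of \<open>n i\<close> leaves some \<open>n i\<close> over.  The new factorization is therefore
  adjacent to \<open>f\<close>, and it is adjacent to \<open>g\<close> or to the result of an exchange in \<open>g\<close>.\<close>

lemma nabla_path_from_pure:
  assumes ijk: "{i, j, k} = {1, 2, 3}" and f: "f j = 0" "f k = 0" "g i = 0" "c i \<le> f i"
    and wt: "weight f = s" "weight g = s" and s: "\<forall>i\<in>{1, 2, 3}. s \<noteq> c i * n i"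
  shows "(vec3 f, vec3 g) \<in> (nabla_edges gens s)\<^sup>*"
proof -
  note i = perm3_mem[OF ijk]
  note ne = perm3_distinct[OF ijk]
  have "f i \<noteq> c i" using s i wt weight_perm[OF ijk, of f] f by auto
  then have fi: "c i < f i" using f by simp
  let ?f = "exchange i f"
  have wf: "weight ?f = s" using weight_exchange[of i f] i f wt by simp
  have fv: "0 < ?f i" "?f j = r i j" "?f k = r i k"
    using fi ne f by (auto simp: exchange_def pure_def mixed_def)
  have e1: "(vec3 f, vec3 ?f) \<in> nabla_edges gens s"
    using nabla_edge[of f s ?f i] wt wf i fi fv by simp
  show ?thesis
  proof (cases "0 < r i j \<and> 0 < g j \<or> 0 < r i k \<and> 0 < g k")
    case True
    then have "(vec3 ?f, vec3 g) \<in> nabla_edges gens s"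
      using nabla_edge[of ?f s g j] nabla_edge[of ?f s g k] wt wf i fv by auto
    with e1 show ?thesis by (meson converse_rtrancl_into_rtrancl r_into_rtrancl)
  next
    case False
    \<comment> \<open>Then the exchanged vector and \<open>g\<close> have disjoint supports, so \<open>g\<close> is a multiple of a
      single generator as well and can be exchanged in turn.\<close>
    have path: "(vec3 f, vec3 g) \<in> (nabla_edges gens s)\<^sup>*"
      if pq: "{i, p, q} = {1, 2, 3}" and rp: "0 < r i p" and g: "g p = 0" "0 < g q"
        and fp: "?f p = r i p" for p q
    proof -
      note ne = perm3_distinct[OF pq]
      note pqm = perm3_mem(2,3)[OF pq]
      have gw: "g q * n q = s"
        using weight_perm[OF pq, of g] g f wt by simp
      have "f i * n i = s" using weight_perm[OF ijk, of f] f wt by simp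
      then have "c q \<le> g q"
        using c_le[OF perm3_rotate(2)[OF pq] g(2), of "f i" 0] gw by simp
      moreover have "g q \<noteq> c q" using gw s pqm by auto
      ultimately have gq: "c q < g q" by simp
      let ?g = "exchange q g"
      have wg: "weight ?g = s" using weight_exchange[of q g] pqm gq wt by simp
      have gv: "0 < ?g q" "?g i = r q i" "?g p = r q p"
        using gq ne f g by (auto simp: exchange_def pure_def mixed_def)
      have "(vec3 ?g, vec3 g) \<in> nabla_edges gens s"
        using nabla_edge[of ?g s g q] wt wg pqm g gv by simp
      moreover have "(vec3 ?f, vec3 ?g) \<in> nabla_edges gens s"
        using r_pos_or[OF perm3_rotate(2)[OF pq]]
      proof
        assume "0 < r q i"
        then show ?thesis using nabla_edge[OF wf wg i(1)] fv gv by simp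
      next
        assume "0 < r q p"
        then show ?thesis using nabla_edge[OF wf wg pqm(1)] rp fp gv by simp
      qed
      ultimately show ?thesis
        using e1 by (meson converse_rtrancl_into_rtrancl r_into_rtrancl)
    qed
    have "weight f \<noteq> 0" using weight_eq_0_iff[OF ijk, of f] fi by auto
    then have "0 < g j \<or> 0 < g k"
      using weight_eq_0_iff[OF ijk, of g] f wt by auto
    then consider "0 < r i j" "g j = 0" "0 < g k" | "0 < r i k" "g k = 0" "0 < g j"
      using False r_pos_or[OF ijk] by auto
    then show ?thesis
      using path[OF ijk] path[OF perm3_rotate(3)[OF ijk]] fv by cases auto
  qed
qed

text \<open>Two factorizations that are not adjacent fall under \<open>disjoint_cases\<close>, and outside the three
  values \<open>c i * n i\<close> they are joined by \<open>nabla_path_from_pure\<close>.\<close>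

lemma betti_elements_subset: "betti_elements gens \<subseteq> (\<lambda>i. c i * n i) ` {1, 2, 3}"
proof
  fix s assume betti: "s \<in> betti_elements gens"
  show "s \<in> (\<lambda>i. c i * n i) ` {1, 2, 3}"
  proof (rule ccontr)
    assume "s \<notin> (\<lambda>i. c i * n i) ` {1, 2, 3}"
    then have s: "\<forall>i\<in>{1, 2, 3}. s \<noteq> c i * n i" by blast
    have "(vec3 f, vec3 g) \<in> (nabla_edges gens s)\<^sup>*"
      if wt: "weight f = s" "weight g = s" for f g
    proof (cases "\<forall>m\<in>{1, 2, 3}. f m = 0 \<or> g m = 0")
      case False
      then show ?thesis using nabla_edge wt by (metis gr0I r_into_rtrancl)
    next
      case disj: True
      show ?thesis
      proof (cases "s = 0")
        case True
        then have "vec3 f = vec3 g"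
          using wt weight_eq_0_iff[of 1 2 3 f] weight_eq_0_iff[of 1 2 3 g]
          by (simp add: vec3_def)
        then show ?thesis by simp
      next
        case False
        then have "weight f = weight g" "0 < weight f" using wt by auto
        then show ?thesis
          using disj
        proof (rule disjoint_cases)
          fix i j k
          assume "{i, j, k} = {1, 2, 3}" "f j = 0" "f k = 0" "g i = 0" "c i \<le> f i"
          then show ?thesis using nabla_path_from_pure wt s by blast
        next
          fix i j k
          assume "{i, j, k} = {1, 2, 3}" "g j = 0" "g k = 0" "f i = 0" "c i \<le> g i"
          then have "(vec3 g, vec3 f) \<in> (nabla_edges gens s)\<^sup>*"
            using nabla_path_from_pure wt s by blast
          then show ?thesis using sym_rtrancl[OF sym_nabla_edges] by (meson symD)
        qed
      qed
    qed
    then have "nabla_connected gens s"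
      unfolding nabla_connected_def factorizations_eq by blast
    then show False using betti by (simp add: betti_elements_def)
  qed
qed

end

section \<open>The relations among three generators\<close>

locale distinct_least_multiples = least_multiples +
  assumes multiples_inj: "inj_on (\<lambda>i. c i * n i) {1, 2, 3}"
begin

lemma multiples_neq:
  assumes "{i, j, k} = {1, 2, 3}"
  shows "c i * n i \<noteq> c j * n j"
  using inj_on_eq_iff[OF multiples_inj perm3_mem(1)[OF assms] perm3_mem(2)[OF assms]]
    perm3_distinct(1)[OF assms] by simp

text \<open>If \<open>r i j = 0\<close>, then \<open>c i * n i\<close> is a multiple of \<open>n k\<close>, in fact a proper one of
  \<open>c k * n k\<close> because the two numbers differ.  Replacing one \<open>c k * n k\<close> in it gives a
  representation of \<open>c i * n i\<close> that contains \<open>r k i\<close> copies of \<open>n i\<close>; cancelling them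
  contradicts the minimality of \<open>c i\<close> unless \<open>r k i = 0\<close>.\<close>

lemma r_zero_step:
  assumes ijk: "{i, j, k} = {1, 2, 3}" and "r i j = 0"
  shows "r k i = 0 \<and> c k * n k < c i * n i"
proof -
  note pos = perm3_pos[OF ijk]
  have eq: "c i * n i = r i k * n k" using c_eq[OF ijk] assms by simp
  have rpos: "0 < r i k" using r_pos_or[OF ijk] assms by simp
  have "c k \<le> r i k"
    using c_le[OF perm3_rotate(2)[OF ijk] rpos, of "c i" 0] eq by simp
  moreover have "c k \<noteq> r i k"
    using multiples_neq[OF perm3_rotate(3)[OF ijk]] eq by auto
  ultimately have less: "c k < r i k" by simp
  have "r k i = 0"
  proof (rule ccontr)
    assume "r k i \<noteq> 0"
    obtain d where d: "0 < d" "c k + d = r i k" using less_imp_add_positive[OF less] by blast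
    have "c i * n i = d * n k + r k i * n i + r k j * n j"
      using eq c_eq[OF perm3_rotate(2)[OF ijk]] unfolding d(2)[symmetric] by (simp add: algebra_simps)
    moreover from this have "r k i * n i < c i * n i" using d pos by simp
    then have lt: "r k i < c i" by simp
    ultimately have "(c i - r k i) * n i = r k j * n j + d * n k"
      by (simp add: diff_mult_distrib)
    then have "c i \<le> c i - r k i" using c_le[OF ijk] lt by simp
    then show False using \<open>r k i \<noteq> 0\<close> lt by simp
  qed
  then show ?thesis using less eq pos by simp
qed

text \<open>A vanishing coefficient propagates cyclically by \<open>r_zero_step\<close>, and the numbers \<open>c i * n i\<close>
  would decrease strictly around the cycle of three indices.\<close>

lemma r_pos:
  assumes ijk: "{i, j, k} = {1, 2, 3}"
  shows "0 < r i j"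
proof (rule ccontr)
  assume "\<not> 0 < r i j"
  then have 1: "r k i = 0" "c k * n k < c i * n i" using r_zero_step[OF ijk] by auto
  then have 2: "r j k = 0" "c j * n j < c k * n k"
    using r_zero_step[OF perm3_rotate(2)[OF ijk]] by auto
  then have "c i * n i < c j * n j"
    using r_zero_step[OF perm3_rotate(1)[OF ijk]] by auto
  with 1 2 show False by simp
qed

text \<open>Otherwise \<open>c i * n i\<close> could be replaced inside \<open>r j i * n i + r j k * n k = c j * n j\<close>;
  the result contains \<open>n j\<close>, and cancelling it contradicts the minimality of \<open>c j\<close>.\<close>

lemma r_less_c:
  assumes jik: "{j, i, k} = {1, 2, 3}"
  shows "r j i < c i"
proof (rule ccontr)
  assume "\<not> r j i < c i"
  then obtain d where d: "r j i = c i + d" using le_Suc_ex not_less by blast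
  note ijk = perm3_rotate(4)[OF jik]
  have eq: "c j * n j = d * n i + r i j * n j + (r i k + r j k) * n k"
    using c_eq[OF jik] c_eq[OF ijk] d by (simp add: algebra_simps)
  have "0 < (r i k + r j k) * n k"
    using r_pos[OF perm3_rotate(3)[OF jik]] perm3_pos[OF ijk] by simp
  with eq have "r i j * n j < c j * n j" by linarith
  then have lt: "r i j < c j" by simp
  have "(c j - r i j) * n j = d * n i + (r i k + r j k) * n k"
    using eq by (simp add: diff_mult_distrib)
  then have "c j \<le> c j - r i j" using c_le[OF jik] lt by simp
  then show False using r_pos[OF ijk] lt by simp
qed

lemma c_le_int:
  assumes "{i, j, k} = {1, 2, 3}" "0 < (t :: int)" "0 \<le> x" "0 \<le> y"
    and "t * int (n i) = x * int (n j) + y * int (n k)"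
  shows "int (c i) \<le> t"
proof -
  have "int (nat t * n i) = int (nat x * n j + nat y * n k)"
    using assms by simp
  then have "nat t * n i = nat x * n j + nat y * n k"
    by (simp only: of_nat_eq_iff)
  then have "c i \<le> nat t" using c_le[OF assms(1)] assms(2) by simp
  then show ?thesis using assms(2) by linarith
qed

text \<open>Adding the three relations gives integers \<open>w i = c i - r j i - r k i\<close> with
  \<open>\<Sum>i. w i * n i = 0\<close>, and \<open>\<bar>w i\<bar> < c i\<close> by the bounds on the coefficients \<open>r\<close>.  If exactly
  one \<open>w i\<close> were of its sign, it would express \<open>\<bar>w i\<bar> * n i\<close> through the other two generators,
  against the minimality of \<open>c i\<close>.  So the \<open>w i\<close> are all nonnegative or all nonpositive, and
  hence vanish.\<close>

lemma c_eq_sum: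
  assumes pqs: "{p, q, s} = {1, 2, 3}"
  shows "c p = r q p + r s p"
proof -
  define w where "w i j k = int (c i) - int (r j i) - int (r k i)" for i j k
  have w_swap: "w i j k = w i k j" for i j k
    by (simp add: w_def)
  have sum: "w i j k * int (n i) + w j k i * int (n j) + w k i j * int (n k) = 0"
    if ijk: "{i, j, k} = {1, 2, 3}" for i j k
  proof -
    have "int (c l) * int (n l) = int (r l p) * int (n p) + int (r l q) * int (n q)"
      if "{l, p, q} = {1, 2, 3}" for l p q
      using c_eq[OF that] by (metis of_nat_add of_nat_mult)
    from this[OF ijk] this[OF perm3_rotate(1)[OF ijk]] this[OF perm3_rotate(2)[OF ijk]]
    show ?thesis by (simp add: w_def algebra_simps)
  qed
  have one_pos: "\<not> (0 < w i j k \<and> w j k i \<le> 0 \<and> w k i j \<le> 0)"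
    if ijk: "{i, j, k} = {1, 2, 3}" for i j k
  proof
    assume *: "0 < w i j k \<and> w j k i \<le> 0 \<and> w k i j \<le> 0"
    have "w i j k * int (n i) = (- w j k i) * int (n j) + (- w k i j) * int (n k)"
      using sum[OF ijk] by simp
    from c_le_int[OF ijk _ _ _ this] * have "int (c i) \<le> w i j k" by simp
    then show False using r_pos[OF perm3_rotate(4)[OF ijk]] by (simp add: w_def)
  qed
  have one_neg: "\<not> (w i j k < 0 \<and> 0 \<le> w j k i \<and> 0 \<le> w k i j)"
    if ijk: "{i, j, k} = {1, 2, 3}" for i j k
  proof
    assume *: "w i j k < 0 \<and> 0 \<le> w j k i \<and> 0 \<le> w k i j"
    have "(- w i j k) * int (n i) = w j k i * int (n j) + w k i j * int (n k)"
      using sum[OF ijk] by simp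
    from c_le_int[OF ijk _ _ _ this] * have "int (c i) \<le> - w i j k" by simp
    then show False
      using r_less_c[OF perm3_rotate(4)[OF ijk]] r_less_c[OF perm3_rotate(2)[OF ijk]]
      by (simp add: w_def)
  qed
  let ?a = "w p q s" and ?b = "w q s p" and ?d = "w s p q"
  note rot = perm3_rotate(1)[OF pqs] perm3_rotate(2)[OF pqs]
  have sum0: "?a * int (n p) + ?b * int (n q) + ?d * int (n s) = 0" using sum[OF pqs] .
  have sgn: "0 \<le> ?a \<and> 0 \<le> ?b \<and> 0 \<le> ?d \<or> ?a \<le> 0 \<and> ?b \<le> 0 \<and> ?d \<le> 0"
    using one_pos[OF pqs] one_pos[OF rot(1)] one_pos[OF rot(2)]
      one_neg[OF pqs] one_neg[OF rot(1)] one_neg[OF rot(2)] by (smt (verit))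
  have pos: "0 < int (n p)" using perm3_pos[OF pqs] by simp
  have "?a * int (n p) = 0"
    using sgn
  proof
    assume "0 \<le> ?a \<and> 0 \<le> ?b \<and> 0 \<le> ?d"
    then have "0 \<le> ?a * int (n p)" "0 \<le> ?b * int (n q)" "0 \<le> ?d * int (n s)" by simp_all
    with sum0 show ?thesis by linarith
  next
    assume "?a \<le> 0 \<and> ?b \<le> 0 \<and> ?d \<le> 0"
    then have "?a * int (n p) \<le> 0" "?b * int (n q) \<le> 0" "?d * int (n s) \<le> 0"
      by (simp_all add: mult_nonpos_nonneg)
    with sum0 show ?thesis by linarith
  qed
  then show ?thesis using pos by (simp add: w_def)
qed

text \<open>A factorization with \<open>0 < f i < c i\<close> would express \<open>(c i - f i) * n i\<close> through the other two
  generators, against the minimality of \<open>c i\<close>.\<close>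

lemma two_factorizations:
  assumes ijk: "{i, j, k} = {1, 2, 3}" and wt: "weight f = c i * n i"
  shows "vec3 f = vec3 (pure i) \<or> vec3 f = vec3 (mixed i)"
proof -
  note pos = perm3_pos[OF ijk] and ne = perm3_distinct[OF ijk]
  have eq: "c i * n i = f i * n i + f j * n j + f k * n k"
    using wt weight_perm[OF ijk, of f] by simp
  then have "f i * n i \<le> c i * n i" by simp
  then have le: "f i \<le> c i" using pos by simp
  have diff: "(c i - f i) * n i = f j * n j + f k * n k"
    using eq by (simp add: diff_mult_distrib)
  consider "f i = c i" | "f i = 0" | "0 < f i" "f i < c i" using le by linarith
  then show ?thesis
  proof cases
    case 1
    then have "vec3 f = vec3 (pure i)"
      using diff pos ne by (simp add: vec3_eq_iff[OF ijk] pure_def)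
    then show ?thesis ..
  next
    case 2
    \<comment> \<open>Two factorizations without \<open>n i\<close> would give a relation between multiples of \<open>n j\<close> and
      \<open>n k\<close> whose coefficients lie below \<open>c j\<close> or \<open>c k\<close>.\<close>
    have eq2: "f p * n p + f q * n q = r i p * n p + r i q * n q"
      if "p = j \<and> q = k \<or> p = k \<and> q = j" for p q
      using that 2 eq c_eq[OF ijk] by auto
    have ge: "r i p \<le> f p"
      if pq: "{i, p, q} = {1, 2, 3}" "p = j \<and> q = k \<or> p = k \<and> q = j" for p q
    proof (rule ccontr)
      assume "\<not> r i p \<le> f p"
      then have lt: "f p < r i p" by simp
      have "int (f p) * int (n p) + int (f q) * int (n q)
          = int (r i p) * int (n p) + int (r i q) * int (n q)"
        using eq2[OF pq(2)] by (metis of_nat_add of_nat_mult)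
      then have rel: "(int (r i p) - int (f p)) * int (n p)
          = 0 * int (n i) + (int (f q) - int (r i q)) * int (n q)"
        by (simp add: algebra_simps)
      have "0 < (int (r i p) - int (f p)) * int (n p)"
        using lt perm3_pos(2)[OF pq(1)] by simp
      then have "0 < (int (f q) - int (r i q)) * int (n q)" using rel by simp
      then have "0 \<le> int (f q) - int (r i q)" by (simp add: zero_less_mult_iff)
      then have "int (c p) \<le> int (r i p) - int (f p)"
        using c_le_int[OF perm3_rotate(4)[OF pq(1)] _ _ _ rel] lt by simp
      then show False using r_less_c[OF pq(1)] by simp
    qed
    have gej: "r i j \<le> f j" using ge[OF ijk] by simp
    have gek: "r i k \<le> f k" using ge[OF perm3_rotate(3)[OF ijk]] by simp
    have "f j * n j + f k * n k = r i j * n j + r i k * n k" using eq2 by simp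
    moreover have "r i j * n j \<le> f j * n j" "r i k * n k \<le> f k * n k" using gej gek by simp_all
    ultimately have "f j * n j = r i j * n j" "f k * n k = r i k * n k" by linarith+
    then have "vec3 f = vec3 (mixed i)"
      using 2 pos ne by (simp add: vec3_eq_iff[OF ijk] mixed_def)
    then show ?thesis ..
  next
    case 3
    then have "c i \<le> c i - f i" using c_le[OF ijk _ diff] by simp
    then show ?thesis using 3 by simp
  qed
qed

section \<open>Exchange moves between factorizations\<close>

text \<open>The common part \<open>u\<close> stays in place while one factorization of \<open>c i * n i\<close> is replaced by the
  other.  The unordered pair makes the relation symmetric.\<close>

definition move :: "nat list \<Rightarrow> nat list \<Rightarrow> bool" where
  "move x y \<longleftrightarrow> (\<exists>i\<in>{1, 2, 3}. \<exists>u.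
     {x, y} = {vec3 (\<lambda>m. u m + pure i m), vec3 (\<lambda>m. u m + mixed i m)})"

lemma symp_move: "symp move"
  by (auto simp: symp_def move_def insert_commute)

lemma move_cases:
  assumes "move x y"
  obtains i u where "i \<in> {1, 2, 3}" "x = vec3 (\<lambda>m. u m + pure i m)"
      "y = vec3 (\<lambda>m. u m + mixed i m)"
    | i u where "i \<in> {1, 2, 3}" "y = vec3 (\<lambda>m. u m + pure i m)"
      "x = vec3 (\<lambda>m. u m + mixed i m)"
  using assms by (auto simp: move_def doubleton_eq_iff)

lemma moveI:
  assumes "i \<in> {1, 2, 3}"
  shows "move (vec3 (\<lambda>m. u m + pure i m)) (vec3 (\<lambda>m. u m + mixed i m))"
  using assms unfolding move_def by blast

lemma move_factorizations:
  assumes "move x y" "x \<in> factorizations gens s"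
  shows "y \<in> factorizations gens s"
  using assms(1)
  by (cases rule: move_cases)
    (use assms(2) in \<open>simp_all only: vec3_in_factorizations weight_add weight_pure weight_mixed\<close>)

lemma moves_factorizations:
  assumes "move\<^sup>*\<^sup>* x y" "x \<in> factorizations gens s"
  shows "y \<in> factorizations gens s"
  using assms by (induction rule: rtranclp_induct) (blast intro: move_factorizations)+

lemma map2_plus_vec3: "map2 (+) (vec3 f) (vec3 w) = vec3 (\<lambda>m. f m + w m)"
  by (simp add: vec3_def)

lemma move_translate:
  assumes "move x y"
  shows "move (map2 (+) x (vec3 w)) (map2 (+) y (vec3 w))"
proof -
  have translated: "move (map2 (+) (vec3 (\<lambda>m. u m + pure i m)) (vec3 w))
      (map2 (+) (vec3 (\<lambda>m. u m + mixed i m)) (vec3 w))" if "i \<in> {1, 2, 3}" for i u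
    using moveI[OF that, of "\<lambda>m. u m + w m"]
    by (simp add: map2_plus_vec3 ac_simps)
  from assms show ?thesis
  proof (cases rule: move_cases)
    case (1 i u) then show ?thesis using translated[of i u] by simp
  next
    case (2 i u) then show ?thesis using sympD[OF symp_move, OF translated[of i u]] by simp
  qed
qed

lemma moves_translate:
  assumes "move\<^sup>*\<^sup>* (vec3 f) (vec3 g)"
  shows "move\<^sup>*\<^sup>* (vec3 (\<lambda>m. f m + w m)) (vec3 (\<lambda>m. g m + w m))"
proof -
  have "move\<^sup>*\<^sup>* (map2 (+) x (vec3 w)) (map2 (+) y (vec3 w))" if "move\<^sup>*\<^sup>* x y" for x y
    using that
    by (induction rule: rtranclp_induct)
      (blast intro: rtranclp.rtrancl_into_rtrancl move_translate)+
  from this[OF assms] show ?thesis by (simp only: map2_plus_vec3)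
qed

lemma move_exchange:
  assumes "i \<in> {1, 2, 3}" "c i \<le> f i"
  shows "move (vec3 f) (vec3 (exchange i f))"
proof -
  have "f = (\<lambda>m. f m - pure i m + pure i m)"
    using assms(2) by (auto simp: pure_def)
  then show ?thesis
    using moveI[OF assms(1), of "\<lambda>m. f m - pure i m"] unfolding exchange_def[abs_def] by simp
qed

text \<open>Induction on the element.  If two factorizations share a generator, it can be split off from
  both.  Otherwise one of them is a multiple of a single generator \<open>n i\<close>; after one exchange
  it involves both other generators, by positivity of the \<open>r i j\<close>, and so it shares one with
  the second factorization.\<close>

lemma moves_connect:
  assumes "weight f = s" "weight g = s"
  shows "move\<^sup>*\<^sup>* (vec3 f) (vec3 g)"
  using assms
proof (induction s arbitrary: f g rule: less_induct)
  case (less s)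
  have overlap: "move\<^sup>*\<^sup>* (vec3 f) (vec3 g)"
    if wt: "weight f = s" "weight g = s" and m: "m \<in> {1, 2, 3}" "0 < f m" "0 < g m"
    for f g m
  proof -
    \<comment> \<open>A shared generator is removed from both vectors and restored along the whole path.\<close>
    define e where "e = (\<lambda>i. if i = m then 1 else 0 :: nat)"
    have "f = (\<lambda>i. (f i - e i) + e i)" "g = (\<lambda>i. (g i - e i) + e i)"
      using m by (auto simp: e_def)
    then obtain f' g' where f: "f = (\<lambda>i. f' i + e i)" and g: "g = (\<lambda>i. g' i + e i)"
      by (elim that)
    have "weight e = n m" using m by (auto simp: e_def weight_def)
    then have "weight f' + n m = s" "weight g' + n m = s"
      using wt unfolding f g weight_add by simp_all
    then have "move\<^sup>*\<^sup>* (vec3 f') (vec3 g')"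
      using less.IH[of "s - n m" f' g'] n_pos[OF m(1)] by simp
    then show ?thesis unfolding f g by (rule moves_translate)
  qed
  have from_pure: "move\<^sup>*\<^sup>* (vec3 f) (vec3 g)"
    if ijk: "{i, j, k} = {1, 2, 3}" and z: "g i = 0" and ci: "c i \<le> f i"
      and wt: "weight f = s" "weight g = s" for f g i j k
  proof -
    note i = perm3_mem[OF ijk]
    have "weight f \<noteq> 0" using weight_eq_0_iff[OF ijk, of f] ci c_pos[OF i(1)] by auto
    then have g: "0 < g j \<or> 0 < g k" using weight_eq_0_iff[OF ijk, of g] z wt by auto
    have "0 < exchange i f j" "0 < exchange i f k"
      using r_pos[OF ijk] r_pos[OF perm3_rotate(3)[OF ijk]] perm3_distinct[OF ijk]
      by (auto simp: exchange_def mixed_def)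
    moreover have "weight (exchange i f) = s" using weight_exchange[of i f] i ci wt by simp
    ultimately have "move\<^sup>*\<^sup>* (vec3 (exchange i f)) (vec3 g)"
      using overlap wt(2) g i by blast
    then show ?thesis
      using move_exchange[of i f] i ci by (meson converse_rtranclp_into_rtranclp)
  qed
  show ?case
  proof (cases "\<forall>m\<in>{1, 2, 3}. f m = 0 \<or> g m = 0")
    case False
    then show ?thesis using overlap less.prems by blast
  next
    case disj: True
    show ?thesis
    proof (cases "s = 0")
      case True
      then have "vec3 f = vec3 g"
        using less.prems weight_eq_0_iff[of 1 2 3 f] weight_eq_0_iff[of 1 2 3 g]
        by (simp add: vec3_def)
      then show ?thesis by simp
    next
      case False
      then have "weight f = weight g" "0 < weight f" using less.prems by auto
      then show ?thesis
        using disj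
      proof (rule disjoint_cases)
        fix i j k
        assume "{i, j, k} = {1, 2, 3}" "g i = 0" "c i \<le> f i"
        then show ?thesis using from_pure less.prems by blast
      next
        fix i j k
        assume "{i, j, k} = {1, 2, 3}" "f i = 0" "c i \<le> g i"
        then have "move\<^sup>*\<^sup>* (vec3 g) (vec3 f)" using from_pure less.prems by blast
        then show ?thesis using symp_move by (meson sympD symp_rtranclp)
      qed
    qed
  qed
qed

lemma moves_connect_factorizations:
  assumes "x \<in> factorizations gens s" "y \<in> factorizations gens s"
  shows "move\<^sup>*\<^sup>* x y"
  using assms moves_connect unfolding factorizations_eq by blast

section \<open>The catenary degree\<close>

definition mixed_length :: "nat \<Rightarrow> nat" where
  "mixed_length i = sum_list (vec3 (mixed i))"

lemma mixed_length_eq: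
  assumes "{i, j, k} = {1, 2, 3}"
  shows "mixed_length i = r i j + r i k"
  using sum_list_vec3[OF assms, of "mixed i"] perm3_distinct[OF assms]
  by (simp add: mixed_length_def mixed_def)

lemma sum_list_vec3_add: "sum_list (vec3 (\<lambda>m. f m + g m)) = sum_list (vec3 f) + sum_list (vec3 g)"
  by (simp add: vec3_def)

lemma sum_list_pure:
  assumes "i \<in> {1, 2, 3}"
  shows "sum_list (vec3 (pure i)) = c i"
  using assms by (auto simp: vec3_def pure_def)

lemma fac_dist_translate:
  "fac_dist (vec3 (\<lambda>m. u m + f m)) (vec3 (\<lambda>m. u m + g m)) = fac_dist (vec3 f) (vec3 g)"
proof -
  have "(\<lambda>m. min (u m + f m) (u m + g m)) = (\<lambda>m. u m + min (f m) (g m))"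
    by (auto simp: min_def)
  then show ?thesis
    unfolding fac_dist_vec3 by (simp add: sum_list_vec3_add)
qed

lemma fac_dist_commute: "fac_dist (vec3 f) (vec3 g) = fac_dist (vec3 g) (vec3 f)"
  unfolding fac_dist_vec3 by (simp add: max.commute min.commute)

lemma fac_dist_pure_mixed:
  assumes "i \<in> {1, 2, 3}"
  shows "fac_dist (vec3 (pure i)) (vec3 (mixed i)) = max (c i) (mixed_length i)"
proof -
  have "(\<lambda>m. min (pure i m) (mixed i m)) = (\<lambda>m. 0)"
    by (auto simp: pure_def mixed_def)
  then have "sum_list (vec3 (\<lambda>m. min (pure i m) (mixed i m))) = 0"
    by (simp add: vec3_def)
  then show ?thesis
    unfolding fac_dist_vec3 sum_list_pure[OF assms] mixed_length_def by (simp only: diff_zero)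
qed

lemma fac_dist_mixed_pure:
  assumes "i \<in> {1, 2, 3}"
  shows "fac_dist (vec3 (mixed i)) (vec3 (pure i)) = max (c i) (mixed_length i)"
  using fac_dist_pure_mixed[OF assms] fac_dist_commute by simp

definition step_bound :: nat where
  "step_bound = Max ((\<lambda>i. max (c i) (mixed_length i)) ` {1, 2, 3})"

lemma fac_dist_move:
  assumes "move x y"
  shows "fac_dist x y \<le> step_bound"
proof -
  have "max (c i) (mixed_length i) \<le> step_bound" if "i \<in> {1, 2, 3}" for i
    unfolding step_bound_def by (rule Max_ge) (use that in auto)
  with assms show ?thesis
    by (cases rule: move_cases)
      (simp_all only: fac_dist_translate fac_dist_pure_mixed fac_dist_mixed_pure)
qed

lemma multiple_in_gens: "i \<in> {1, 2, 3} \<Longrightarrow> c i * n i \<in> generated (set gens)"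
  by (rule multiple_in_generated) auto

lemma pure_in_factorizations:
  "i \<in> {1, 2, 3} \<Longrightarrow> vec3 (pure i) \<in> factorizations gens (c i * n i)"
  by (simp only: vec3_in_factorizations weight_pure)

lemma mixed_in_factorizations:
  "i \<in> {1, 2, 3} \<Longrightarrow> vec3 (mixed i) \<in> factorizations gens (c i * n i)"
  by (simp only: vec3_in_factorizations weight_mixed)

lemma factorizations_multiple:
  assumes "i \<in> {1, 2, 3}"
  shows "factorizations gens (c i * n i) = {vec3 (pure i), vec3 (mixed i)}"
proof -
  obtain j k where "{i, j, k} = {1, 2, 3}" using perm3_complete[OF assms] .
  then have "factorizations gens (c i * n i) \<subseteq> {vec3 (pure i), vec3 (mixed i)}"
    unfolding factorizations_eq using two_factorizations by blast
  then show ?thesis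
    using pure_in_factorizations[OF assms] mixed_in_factorizations[OF assms] by blast
qed

lemma elem_catenary_degree_le: "elem_catenary_degree gens s \<le> enat step_bound"
  unfolding elem_catenary_degree_le_iff
proof (intro ballI)
  fix a b assume ab: "a \<in> factorizations gens s" "b \<in> factorizations gens s"
  then have "move\<^sup>*\<^sup>* a b" by (rule moves_connect_factorizations)
  then show "(fac_step gens s (enat step_bound))\<^sup>*\<^sup>* a b"
  proof (induction rule: rtranclp_induct)
    case base
    show ?case by simp
  next
    case (step y z)
    have "y \<in> factorizations gens s" using moves_factorizations[OF step(1) ab(1)] .
    then have "fac_step gens s (enat step_bound) y z"
      using move_factorizations fac_dist_move step(2) by (auto simp: fac_step_def)
    with step.IH show ?case by simp
  qed
qed

text \<open>With only two factorizations, a chain between them must step directly from one to the other.\<close>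

lemma elem_catenary_degree_multiple:
  assumes i: "i \<in> {1, 2, 3}"
  shows "enat (max (c i) (mixed_length i)) \<le> elem_catenary_degree gens (c i * n i)"
    (is "_ \<le> ?N")
proof -
  let ?R = "fac_step gens (c i * n i) ?N"
  have ne: "vec3 (mixed i) \<noteq> vec3 (pure i)"
  proof -
    obtain j k where "{i, j, k} = {1, 2, 3}" using perm3_complete[OF i] .
    from vec3_eq_iff[OF this, of "mixed i" "pure i"] show ?thesis
      using c_pos[OF i] by (simp add: pure_def mixed_def)
  qed
  have path: "?R\<^sup>*\<^sup>* (vec3 (pure i)) (vec3 (mixed i))"
    using elem_catenary_degree_le_iff[of gens "c i * n i" ?N]
      pure_in_factorizations[OF i] mixed_in_factorizations[OF i] by blast
  obtain x y where "?R x y" "x = vec3 (pure i)" "y \<noteq> vec3 (pure i)"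
    by (rule rtranclp_crossing[OF path, where P = "\<lambda>z. z = vec3 (pure i)"]) (use ne in simp_all)
  then have "?R (vec3 (pure i)) (vec3 (mixed i))"
    using factorizations_multiple[OF i] by (auto simp: fac_step_def)
  then show ?thesis
    using fac_dist_pure_mixed[OF i] by (simp add: fac_step_def)
qed

lemma catenary_degree_eq: "catenary_degree gens = enat step_bound"
proof (rule antisym)
  show "catenary_degree gens \<le> enat step_bound"
    unfolding catenary_degree_def by (rule SUP_least) (rule elem_catenary_degree_le)
  have "step_bound \<in> (\<lambda>i. max (c i) (mixed_length i)) ` {1, 2, 3}"
    unfolding step_bound_def by (rule Max_in) auto
  then obtain i where i: "i \<in> {1, 2, 3}" "step_bound = max (c i) (mixed_length i)" by blast
  have "elem_catenary_degree gens (c i * n i) \<le> catenary_degree gens"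
    unfolding catenary_degree_def using multiple_in_gens[OF i(1)] by (rule SUP_upper)
  then show "enat step_bound \<le> catenary_degree gens"
    unfolding i(2) by (rule order_trans[OF elem_catenary_degree_multiple[OF i(1)]])
qed

section \<open>The Delta set\<close>

definition jump_bound :: nat where
  "jump_bound = Max ((\<lambda>i. max (c i - mixed_length i) (mixed_length i - c i)) ` {1, 2, 3})"

lemma jump_le:
  assumes "i \<in> {1, 2, 3}"
  shows "c i - mixed_length i \<le> jump_bound" "mixed_length i - c i \<le> jump_bound"
proof -
  have "max (c i - mixed_length i) (mixed_length i - c i) \<le> jump_bound"
    unfolding jump_bound_def by (rule Max_ge) (use assms in auto)
  then show "c i - mixed_length i \<le> jump_bound" "mixed_length i - c i \<le> jump_bound" by simp_all
qed

lemma move_length: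
  assumes "move x y"
  shows "sum_list y \<le> sum_list x + jump_bound"
  using assms
proof (cases rule: move_cases)
  case (1 i u)
  then show ?thesis
    using jump_le[of i] sum_list_pure[of i]
    by (simp add: sum_list_vec3_add mixed_length_def del: insert_iff)
next
  case (2 i u)
  then show ?thesis
    using jump_le[of i] sum_list_pure[of i]
    by (simp add: sum_list_vec3_add mixed_length_def del: insert_iff)
qed

text \<open>A path of moves from length \<open>l\<close> to the next length \<open>m\<close> contains a move that starts at length
  at most \<open>l\<close> and ends above \<open>l\<close>, hence at length at least \<open>m\<close>.\<close>

lemma delta_le:
  assumes "d \<in> delta gens s"
  shows "d \<le> jump_bound"
proof -
  obtain l m where d: "d = m - l" and lm: "l \<in> length_set gens s" "m \<in> length_set gens s" "l < m"
    and gap: "\<forall>k\<in>length_set gens s. \<not> (l < k \<and> k < m)"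
    using assms by (auto simp: delta_def)
  obtain x y where x: "x \<in> factorizations gens s" "l = sum_list x"
    and y: "y \<in> factorizations gens s" "m = sum_list y"
    using lm by (auto simp: length_set_def)
  have path: "move\<^sup>*\<^sup>* x y" using x(1) y(1) by (rule moves_connect_factorizations)
  obtain a b where ab: "move\<^sup>*\<^sup>* x a" "move a b" "sum_list a \<le> l" "\<not> sum_list b \<le> l"
    by (rule rtranclp_crossing[OF path, where P = "\<lambda>z. sum_list z \<le> l"]) (use x y lm in auto)
  have "b \<in> factorizations gens s"
    using moves_factorizations[OF ab(1) x(1)] move_factorizations ab(2) by blast
  then have "m \<le> sum_list b" using gap ab(4) by (force simp: length_set_def)
  then show ?thesis using move_length[OF ab(2)] ab(3) d by linarith
qed

lemma delta_multiple:
  assumes "i \<in> {1, 2, 3}" "c i \<noteq> mixed_length i"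
  shows "max (c i - mixed_length i) (mixed_length i - c i) \<in> delta gens (c i * n i)"
proof -
  have L: "length_set gens (c i * n i) = {c i, mixed_length i}"
    unfolding length_set_def factorizations_multiple[OF assms(1)]
    by (simp add: sum_list_pure[OF assms(1)] mixed_length_def)
  consider "c i < mixed_length i" | "mixed_length i < c i" using assms(2) by linarith
  then show ?thesis
    unfolding delta_def L by cases (force simp: max_def)+
qed

text \<open>The hypothesis provides a nonzero jump.  Without one, each element would have a single length
  and the Delta set would be empty.\<close>

lemma Max_delta_set:
  assumes "\<exists>i\<in>{1, 2, 3}. c i \<noteq> mixed_length i"
  shows "Max (delta_set gens) = jump_bound"
proof (rule Max_eqI)
  show "finite (delta_set gens)"
    by (rule finite_subset[of _ "{..jump_bound}"]) (auto simp: delta_set_def delta_le)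
  show "d \<le> jump_bound" if "d \<in> delta_set gens" for d
    using that delta_le by (auto simp: delta_set_def)
  obtain i0 where i0: "i0 \<in> {1, 2, 3}" "c i0 \<noteq> mixed_length i0" using assms by blast
  then have pos: "0 < jump_bound" using jump_le[OF i0(1)] by linarith
  have "jump_bound \<in> (\<lambda>i. max (c i - mixed_length i) (mixed_length i - c i)) ` {1, 2, 3}"
    unfolding jump_bound_def by (rule Max_in) auto
  then obtain i where i: "i \<in> {1, 2, 3}"
    "jump_bound = max (c i - mixed_length i) (mixed_length i - c i)" by blast
  then have "c i \<noteq> mixed_length i" using pos by auto
  then show "jump_bound \<in> delta_set gens"
    using delta_multiple i multiple_in_gens unfolding delta_set_def by auto
qed

end

section \<open>Comparison of the two invariants\<close>

text \<open>In \<open>max (c1 - (r12 + r13)) (r31 + r32 - c3) + 2\<close> neither entry, increased by \<open>2\<close>, exceeds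
  \<open>c1\<close> respectively \<open>r31 + r32\<close>, as \<open>r12 + r13\<close> and \<open>c3\<close> are at least \<open>2\<close>.  So equality holds
  precisely if one of these entries reaches the right-hand side.  In the second alternative the
  bound \<open>r21 + r23 \<le> r31 + r32\<close> follows from that on \<open>c1\<close>, since \<open>c3 = 2\<close> forces \<open>r23 = 1\<close> and
  \<open>r21 + 1 \<le> c1\<close>.  In the first one, the case \<open>r21 + r23 \<le> c2\<close> forces \<open>c3 = 2\<close> and
  \<open>r31 + r32 = c1\<close>, which belongs to the second alternative.\<close>

lemma criterion_arithmetic:
  fixes c1 c2 c3 r12 r13 r21 r23 r31 r32 :: nat
  assumes pos: "0 < r12" "0 < r13" "0 < r21" "0 < r23" "0 < r31" "0 < r32"
    and c: "c1 = r21 + r31" "c2 = r12 + r32" "c3 = r13 + r23"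
    and len: "r12 + r13 < c1" "c3 < r31 + r32"
  shows "max (c1 - (r12 + r13)) (r31 + r32 - c3) + 2
      = max (max c1 (r12 + r13)) (max (max c2 (r21 + r23)) (max c3 (r31 + r32))) \<longleftrightarrow>
    (r12 = 1 \<and> r13 = 1 \<and> r21 + r23 > c2 \<and> c1 \<ge> max (r21 + r23) (r31 + r32)) \<or>
    (c3 = 2 \<and> r31 + r32 \<ge> max c1 c2)"
proof -
  let ?l2 = "r21 + r23" and ?l3 = "r31 + r32"
  let ?d1 = "c1 - (r12 + r13)" and ?d3 = "?l3 - c3"
  let ?M = "max (max c1 (r12 + r13)) (max (max c2 ?l2) (max c3 ?l3))"
  have d1: "?d1 + (r12 + r13) = c1" and d3: "?d3 + c3 = ?l3" using len by simp_all
  have M: "?M = max c1 (max (max c2 ?l2) ?l3)" using len by simp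
  have upper: "c1 \<le> ?M" "?l3 \<le> ?M" by simp_all
  have "max ?d1 ?d3 + 2 \<le> ?M" using d1 d3 upper pos c by linarith
  then have "max ?d1 ?d3 + 2 = ?M \<longleftrightarrow> ?M \<le> ?d1 + 2 \<or> ?M \<le> ?d3 + 2" by linarith
  also have "?M \<le> ?d1 + 2 \<longleftrightarrow> r12 = 1 \<and> r13 = 1 \<and> max (max c2 ?l2) ?l3 \<le> c1"
    unfolding M max.bounded_iff using d1 pos by linarith
  also have "?M \<le> ?d3 + 2 \<longleftrightarrow> c3 = 2 \<and> max c1 c2 \<le> ?l3"
    unfolding M max.bounded_iff using d3 pos c by linarith
  also have "r12 = 1 \<and> r13 = 1 \<and> max (max c2 ?l2) ?l3 \<le> c1 \<or> c3 = 2 \<and> max c1 c2 \<le> ?l3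
      \<longleftrightarrow> r12 = 1 \<and> r13 = 1 \<and> c2 < ?l2 \<and> max ?l2 ?l3 \<le> c1 \<or> c3 = 2 \<and> max c1 c2 \<le> ?l3"
    unfolding max.bounded_iff using pos c by linarith
  finally show ?thesis by simp
qed

theorem theorem3p9:
  fixes S :: "nat set" and n :: "nat \<Rightarrow> nat" and c :: "nat \<Rightarrow> nat" and r :: "nat \<Rightarrow> nat \<Rightarrow> nat"
  assumes "numerical_semigroup S"
    and "n 1 < n 2" and "n 2 < n 3"
    and "minimal_generators S [n 1, n 2, n 3]"
    and "card (betti_elements [n 1, n 2, n 3]) = 3"
    and "\<And>i j k. {i, j, k} = {1, 2, 3} \<Longrightarrow>
           c i = (LEAST t. 0 < t \<and> t * n i \<in> generated {n j, n k})"
    and "\<And>i j k. {i, j, k} = {1, 2, 3} \<Longrightarrow>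
           c i * n i = r i j * n j + r i k * n k"
  shows "enat (Max (delta_set [n 1, n 2, n 3]) + 2) = catenary_degree [n 1, n 2, n 3] \<longleftrightarrow>
           (r 1 2 = 1 \<and> r 1 3 = 1 \<and> r 2 1 + r 2 3 > c 2 \<and>
              c 1 \<ge> max (r 2 1 + r 2 3) (r 3 1 + r 3 2)) \<or>
           (c 3 = 2 \<and> r 3 1 + r 3 2 \<ge> max (c 1) (c 2))"
proof -
  have npos: "0 < n i" if "i \<in> {1, 2, 3}" for i
    using minimal_generators_nonzero[OF assms(4)] that by auto
  have neq: "n j \<noteq> n k" if "{i, j, k} = {1, 2, 3}" for i j k
    by (rule perm3_cases[OF that]) (use assms(2,3) in simp_all)
  have least: "0 < c i \<and> c i * n i \<in> generated {n j, n k}"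
    if ijk: "{i, j, k} = {1, 2, 3}" for i j k
  proof -
    have "0 < n j \<and> n j * n i \<in> generated {n j, n k}"
      using npos[of j] ijk multiple_in_generated[of "n j" "{n j, n k}" "n i"]
      by (auto simp: mult.commute)
    then show ?thesis unfolding assms(6)[OF ijk] by (rule LeastI)
  qed
  interpret least_multiples n c r
  proof
    show "0 < n i" if "i \<in> {1, 2, 3}" for i using npos that .
    show "0 < c i" if "i \<in> {1, 2, 3}" for i
      using least perm3_complete[OF that] by metis
    show "c i \<le> t" if ijk: "{i, j, k} = {1, 2, 3}" and t: "0 < t" "t * n i = x * n j + y * n k"
      for i j k t x y
    proof -
      have "t * n i \<in> generated {n j, n k}"
        unfolding generated_pair[OF neq[OF ijk]] using t by blast
      then show ?thesis unfolding assms(6)[OF ijk] using t(1) by (simp add: Least_le)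
    qed
    show "c i * n i = r i j * n j + r i k * n k" if "{i, j, k} = {1, 2, 3}" for i j k
      using assms(7)[OF that] .
  qed
  have "3 \<le> card ((\<lambda>i. c i * n i) ` {1, 2, 3})"
    using card_mono[OF _ betti_elements_subset] assms(5) by simp
  moreover have "card ((\<lambda>i. c i * n i) ` {1, 2, 3}) \<le> card {1, 2, 3 :: nat}"
    by (rule card_image_le) simp
  ultimately have "card ((\<lambda>i. c i * n i) ` {1, 2, 3}) = card {1, 2, 3 :: nat}"
    by simp
  then have "inj_on (\<lambda>i. c i * n i) {1, 2, 3}"
    by (intro eq_card_imp_inj_on) simp_all
  then interpret distinct_least_multiples n c r
    by unfold_locales
  have perms: "{1, 2, 3} = {1, 2, 3 :: nat}" "{1, 3, 2} = {1, 2, 3 :: nat}"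
    "{2, 1, 3} = {1, 2, 3 :: nat}" "{2, 3, 1} = {1, 2, 3 :: nat}"
    "{3, 1, 2} = {1, 2, 3 :: nat}" "{3, 2, 1} = {1, 2, 3 :: nat}"
    by auto
  note r = perms[THEN r_pos]
  note cs = c_eq_sum[OF perms(1)] c_eq_sum[OF perms(3)] c_eq_sum[OF perms(5)]
  note ml = mixed_length_eq[OF perms(1)] mixed_length_eq[OF perms(3)] mixed_length_eq[OF perms(5)]
  \<comment> \<open>The smallest generator needs more copies, and the largest one fewer, than the other
    generators that replace it.\<close>
  have "(r 1 2 + r 1 3) * n 1 < r 1 2 * n 2 + r 1 3 * n 3"
    unfolding add_mult_distrib
    by (rule add_strict_mono) (use r assms(2,3) in simp_all)
  then have len1: "r 1 2 + r 1 3 < c 1"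
    using c_eq[OF perms(1)] by (metis mult_less_cancel2)
  have "r 3 1 * n 1 + r 3 2 * n 2 < (r 3 1 + r 3 2) * n 3"
    unfolding add_mult_distrib
    by (rule add_strict_mono) (use r assms(2,3) in simp_all)
  then have len3: "c 3 < r 3 1 + r 3 2"
    using c_eq[OF perms(5)] by (metis mult_less_cancel2)
  let ?d1 = "c 1 - (r 1 2 + r 1 3)" and ?d3 = "r 3 1 + r 3 2 - c 3"
  \<comment> \<open>The middle index contributes the difference of the two outer ones, which is dominated.\<close>
  have "c 2 - (r 2 1 + r 2 3) \<le> ?d3" "r 2 1 + r 2 3 - c 2 \<le> ?d1"
    using len1 len3 cs by simp_all
  then have middle: "max (c 2 - (r 2 1 + r 2 3)) (r 2 1 + r 2 3 - c 2) \<le> max ?d1 ?d3"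
    by (intro max.boundedI) (auto intro: max.coboundedI1 max.coboundedI2)
  have "max ?d1 (r 1 2 + r 1 3 - c 1) = ?d1" "max (c 3 - (r 3 1 + r 3 2)) ?d3 = ?d3"
    using len1 len3 by simp_all
  then have "jump_bound = max ?d1 (max (max (c 2 - (r 2 1 + r 2 3)) (r 2 1 + r 2 3 - c 2)) ?d3)"
    by (simp add: jump_bound_def ml del: One_nat_def)
  also have "\<dots> = max ?d1 ?d3"
    by (subst max.left_commute) (rule max.absorb2[OF middle])
  finally have jump: "jump_bound = max ?d1 ?d3" .
  have "c 1 \<noteq> mixed_length 1" using len1 unfolding ml by simp
  then have Max_eq: "Max (delta_set [n 1, n 2, n 3]) = jump_bound"
    by (intro Max_delta_set bexI[of _ 1]) simp_all
  have cat_eq: "catenary_degree [n 1, n 2, n 3] = enat (max (max (c 1) (r 1 2 + r 1 3))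
      (max (max (c 2) (r 2 1 + r 2 3)) (max (c 3) (r 3 1 + r 3 2))))"
    unfolding catenary_degree_eq by (simp add: step_bound_def ml del: One_nat_def)
  show ?thesis
    unfolding Max_eq cat_eq jump enat.inject
    by (rule criterion_arithmetic[OF r(1,2,3,4,5,6) cs len1 len3])
qed

end
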